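(* Let $\mathbb{K}$ be a field of characteristic $0$, let $L=\sum_{i=0}^{J}a_i(k)\sigma^i\in \mathbb{K}[k][\sigma]$ with $a_J(k)\neq 0$, and let $d=\deg(L)$. Suppose $L$ is nondegenerated and there exists $\gamma\in\mathbb{K}$ such that $$a_i(\gamma+k)=(-1)^d a_{J-i}(\gamma-k-J),\quad i=0,1,\ldots,\lfloor J/2\rfloor.$$ Then for every positive integer $m$, the coset $[(k-\gamma)^m]_L$ lies in the $\mathbb{K}$-linear span of the cosets $[(k-\gamma)^i]_L$ with $0\le i<d$ and $i\equiv m \pmod 2$.
   Context: $\sigma$ denotes the shift operator, $\sigma F(k)=F(k+1)$. For $L=\sum_{i=0}^{J}a_i(k)\sigma^i$ with $a_i(k)\in\mathbb{K}[k]$, its adjoint acts on polynomials by $L^{\ast}(x(k))=\sum_{i=0}^{J}a_i(k-i)x(k-i)$. $S_L=\{L^{\ast}(x(k))\mid x(k)\in\mathbb{K}[k]\}$ and $[p(k)]_L=p(k)+S_L\in \mathbb{K}[k]/S_L$. Set $b_{\ell}(k)=\sum_{j=\ell}^{J}\binom{j}{\ell}a_{J-j}(k+j-J)$ for $0\le\ell\le J$, and $d=\deg(L)=\max_{0\leq \ell \leq J}\{\deg b_\ell(k)-\ell\}$. Let $f(s)=\sum_{\ell=0}^{J}[k^{d+\ell}](b_\ell(k))\,s^{\underline{\ell}}$, where $[k^{m}](b)$ is the coefficient of $k^m$ in $b$ and $s^{\underline{\ell}}=s(s-1)\cdots(s-\ell+1)$. $L$ is called nondegenerated if $f$ has no root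 in $\mathbb{N}=\{0,1,2,\dots\}$. *)

theory Defs
  imports "HOL-Computational_Algebra.Polynomial" "HOL-Library.Set_Algebras"
begin

text \<open>
  The operator \<open>L = a\<^sub>0 + a\<^sub>1 \<sigma> + \<dots> + a\<^sub>J \<sigma>\<^sup>J\<close> is given by its order \<open>J\<close> and its coefficients
  \<open>a 0, \<dots>, a J\<close>; the values of \<open>a\<close> beyond \<open>J\<close> are irrelevant. The shift \<open>p(k + c)\<close> of a
  polynomial is \<open>pcompose p [:c, 1:]\<close>.
\<close>

definition adjoint :: "nat \<Rightarrow> (nat \<Rightarrow> 'a::field_char_0 poly) \<Rightarrow> 'a poly \<Rightarrow> 'a poly" where
  "adjoint J a x = (\<Sum>i\<le>J. pcompose (a i) [:- of_nat i, 1:] * pcompose x [:- of_nat i, 1:])"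

definition adjoint_image :: "nat \<Rightarrow> (nat \<Rightarrow> 'a::field_char_0 poly) \<Rightarrow> 'a poly set" where
  "adjoint_image J a = range (adjoint J a)"

definition b_coeff :: "nat \<Rightarrow> (nat \<Rightarrow> 'a::field_char_0 poly) \<Rightarrow> nat \<Rightarrow> 'a poly" where
  "b_coeff J a l =
     (\<Sum>j=l..J. of_nat (j choose l) * pcompose (a (J - j)) [:of_nat j - of_nat J, 1:])"

text \<open>
  The degree of an operator is an integer and may be negative (it is \<open>-1\<close> for \<open>\<sigma> - 1\<close>).
  The zero polynomial has degree \<open>-\<infinity>\<close>, so vanishing \<open>b\<^sub>l\<close> do not contribute to the
  maximum. If some coefficient \<open>a i\<close> with \<open>i \<le> J\<close> is nonzero, then so is some \<open>b\<^sub>l\<close>.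
\<close>

definition op_degree :: "nat \<Rightarrow> (nat \<Rightarrow> 'a::field_char_0 poly) \<Rightarrow> int" where
  "op_degree J a = Max {int (degree (b_coeff J a l)) - int l | l. l \<le> J \<and> b_coeff J a l \<noteq> 0}"

definition int_coeff :: "'a::zero poly \<Rightarrow> int \<Rightarrow> 'a" where
  "int_coeff p n = (if n < 0 then 0 else coeff p (nat n))"

definition falling_factorial :: "'a::comm_ring_1 \<Rightarrow> nat \<Rightarrow> 'a" where
  "falling_factorial s l = (\<Prod>i<l. s - of_nat i)"

definition indicial :: "nat \<Rightarrow> (nat \<Rightarrow> 'a::field_char_0 poly) \<Rightarrow> 'a \<Rightarrow> 'a" where
  "indicial J a s =
     (\<Sum>l\<le>J. int_coeff (b_coeff J a l) (op_degree J a + int l) * falling_factorial s l)"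

definition nondegenerated :: "nat \<Rightarrow> (nat \<Rightarrow> 'a::field_char_0 poly) \<Rightarrow> bool" where
  "nondegenerated J a \<longleftrightarrow> (\<forall>n::nat. indicial J a (of_nat n) \<noteq> 0)"

text \<open>
  The quotient of the polynomials by a linear subspace \<open>S\<close>: its elements are the cosets
  \<open>p +o S\<close>, its zero is \<open>S\<close>, and its addition is the elementwise sum of sets. In the scalar
  multiplication, adding \<open>S\<close> only matters for \<open>c = 0\<close>, where \<open>smult 0 ` X\<close> is \<open>{0}\<close>.
\<close>

definition quot_scale :: "'a::field poly set \<Rightarrow> 'a \<Rightarrow> 'a poly set \<Rightarrow> 'a poly set" where
  "quot_scale S c X = smult c ` X + S"

definition quot_subspace :: "'a::field poly set \<Rightarrow> 'a poly set set \<Rightarrow> bool" where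
  "quot_subspace S V \<longleftrightarrow> V \<subseteq> range (\<lambda>p. p +o S) \<and> S \<in> V \<and>
     (\<forall>X\<in>V. \<forall>Y\<in>V. X + Y \<in> V) \<and> (\<forall>c. \<forall>X\<in>V. quot_scale S c X \<in> V)"

definition quot_span :: "'a::field poly set \<Rightarrow> 'a poly set set \<Rightarrow> 'a poly set set" where
  "quot_span S G = quot_subspace S hull G"

definition op_coset :: "nat \<Rightarrow> (nat \<Rightarrow> 'a::field_char_0 poly) \<Rightarrow> 'a poly \<Rightarrow> 'a poly set" where
  "op_coset J a p = p +o adjoint_image J a"

lemma adjoint_image_zero: "0 \<in> adjoint_image J a"
proof -
  have "adjoint J a 0 = 0" by (simp add: adjoint_def)
  then show ?thesis unfolding adjoint_image_def by (metis rangeI)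
qed

lemma adjoint_image_add:
  assumes "p \<in> adjoint_image J a" "q \<in> adjoint_image J a"
  shows "p + q \<in> adjoint_image J a"
proof -
  have *: "adjoint J a (x + y) = adjoint J a x + adjoint J a y" for x y
    by (simp add: adjoint_def pcompose_add distrib_left sum.distrib)
  show ?thesis using assms unfolding adjoint_image_def by (auto simp flip: *)
qed

lemma adjoint_image_smult:
  fixes a :: "nat \<Rightarrow> 'a::field_char_0 poly"
  assumes "p \<in> adjoint_image J a"
  shows "smult c p \<in> adjoint_image J a"
proof -
  have *: "adjoint J a (smult c x) = smult c (adjoint J a x)" for x
  proof -
    have "smult c (sum f A) = (\<Sum>i\<in>A. smult c (f i))" for f :: "nat \<Rightarrow> 'a poly" and A
      by (induction A rule: infinite_finite_induct) (simp_all add: smult_add_right)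
    then show ?thesis by (simp add: adjoint_def pcompose_smult)
  qed
  show ?thesis using assms unfolding adjoint_image_def by (auto simp flip: *)
qed

lemma op_coset_add: "op_coset J a p + op_coset J a q = op_coset J a (p + q)"
proof -
  have "adjoint_image J a + adjoint_image J a = adjoint_image J a"
  proof
    show "adjoint_image J a + adjoint_image J a \<subseteq> adjoint_image J a"
      by (auto simp: set_plus_def intro: adjoint_image_add)
    show "adjoint_image J a \<subseteq> adjoint_image J a + adjoint_image J a"
      by (rule set_zero_plus2[OF adjoint_image_zero])
  qed
  then show ?thesis by (simp add: op_coset_def set_plus_rearrange)
qed

lemma op_coset_scale:
  "quot_scale (adjoint_image J a) c (op_coset J a p) = op_coset J a (smult c p)"
proof
  show "quot_scale (adjoint_image J a) c (op_coset J a p) \<subseteq> op_coset J a (smult c p)"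
  proof
    fix x assume "x \<in> quot_scale (adjoint_image J a) c (op_coset J a p)"
    then obtain u v where "u \<in> adjoint_image J a" "v \<in> adjoint_image J a"
      "x = smult c (p + u) + v"
      by (auto simp: quot_scale_def op_coset_def set_plus_def elt_set_plus_def)
    then show "x \<in> op_coset J a (smult c p)"
      by (auto simp: op_coset_def elt_set_plus_def smult_add_right add.assoc
          intro!: bexI[of _ "smult c u + v"] adjoint_image_add adjoint_image_smult)
  qed
  show "op_coset J a (smult c p) \<subseteq> quot_scale (adjoint_image J a) c (op_coset J a p)"
  proof
    fix x assume "x \<in> op_coset J a (smult c p)"
    then obtain v where v: "v \<in> adjoint_image J a" "x = smult c p + v"
      by (auto simp: op_coset_def elt_set_plus_def)
    have "p \<in> op_coset J a p"
      using adjoint_image_zero by (force simp: op_coset_def elt_set_plus_def)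
    with v show "x \<in> quot_scale (adjoint_image J a) c (op_coset J a p)"
      unfolding quot_scale_def by (auto intro: set_plus_intro)
  qed
qed

end

theory Submission
  imports Defs
begin

text \<open>
  Put \<open>t = k - \<gamma>\<close>. By the symmetry hypothesis, the reflection \<open>t \<mapsto> -t\<close> carries \<open>L\<^sup>*(x)\<close> to
  \<open>(-1)\<^sup>d L\<^sup>*(y)\<close>, where \<open>y\<close> is the reflection of \<open>x\<close> about \<open>\<gamma> - J/2\<close>. Hence for
  \<open>x = (k - \<gamma> + J/2)\<^sup>s\<close> the polynomial \<open>L\<^sup>*(x)\<close> contains only powers of \<open>t\<close> of the parity of
  \<open>d + s\<close>. Newton's formula gives \<open>L\<^sup>*(x)(k) = \<Sum>\<^sub>l b\<^sub>l(k) \<Delta>\<^sup>l x(k - J)\<close>, so \<open>L\<^sup>*(x)\<close> has degree at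
  most \<open>d + s\<close> and its coefficient there is \<open>f(s) \<noteq> 0\<close>. Moreover \<open>d \<ge> 0\<close>, because
  \<open>f(0) = 0\<close> when \<open>d < 0\<close>. For \<open>m \<ge> d\<close>, taking \<open>s = m - d\<close>
  expresses \<open>[t\<^sup>m]\<close> by the classes of lower powers of the same parity.
\<close>

section \<open>Forward differences and Newton's formula for the adjoint\<close>

definition fwd_diff :: "'a::comm_ring_1 poly \<Rightarrow> 'a poly" where
  "fwd_diff p = pcompose p [:1, 1:] - p"

text \<open>Newton's formula: the shift by 1 is identity plus \<open>fwd_diff\<close>, so its
  \<open>j\<close>-th power expands binomially. The induction step is Pascal's rule.\<close>

lemma pcompose_shift_eq_sum_fwd_diff:
  "pcompose p [:of_nat j, 1:] = (\<Sum>l\<le>j. of_nat (j choose l) * (fwd_diff ^^ l) p)"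
proof (induction j arbitrary: p)
  case 0
  then show ?case by (simp add: pcompose_idR)
next
  case (Suc j)
  have "pcompose p [:of_nat (Suc j), 1:] = pcompose (pcompose p [:1, 1:]) [:of_nat j, 1:]"
    by (simp flip: pcompose_assoc add: pcompose_pCons)
  also have "pcompose p [:1, 1:] = p + fwd_diff p"
    by (simp add: fwd_diff_def)
  also have "pcompose (p + fwd_diff p) [:of_nat j, 1:] =
      (\<Sum>l\<le>j. of_nat (j choose l) * (fwd_diff ^^ l) p)
      + (\<Sum>l\<le>j. of_nat (j choose l) * (fwd_diff ^^ Suc l) p)"
    by (subst pcompose_add) (simp only: Suc.IH funpow_Suc_right comp_apply)
  \<comment> \<open>The added term \<open>l = Suc j\<close> has binomial coefficient 0. Splitting
    off \<open>l = 0\<close> afterwards aligns this sum with the other one for Pascal's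
    rule.\<close>
  also have "(\<Sum>l\<le>j. of_nat (j choose l) * (fwd_diff ^^ l) p) =
      (\<Sum>l\<le>Suc j. of_nat (j choose l) * (fwd_diff ^^ l) p)"
    by (simp add: binomial_eq_0)
  also have "\<dots> = p + (\<Sum>l\<le>j. of_nat (j choose Suc l) * (fwd_diff ^^ Suc l) p)"
    by (subst sum.atMost_Suc_shift) simp
  finally show ?case
    by (subst sum.atMost_Suc_shift) (simp add: sum.distrib algebra_simps)
qed

text \<open>For linear \<open>q\<close> this reduces coefficients of a composition to binomial
  coefficients; for \<open>q = [:- \<gamma>, 1:]\<close> it is the expansion in powers of
  \<open>k - \<gamma>\<close>.\<close>

lemma pcompose_eq_sum_powers:
  fixes p :: "'a::comm_ring_1 poly"
  assumes "degree p \<le> n"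
  shows "pcompose p q = (\<Sum>i\<le>n. smult (coeff p i) (q ^ i))"
proof -
  have mon: "pcompose (monom c i) q = smult c (q ^ i)" for c i
    by (induction i) (simp_all add: monom_0 monom_Suc pcompose_pCons)
  have "pcompose p q = pcompose (\<Sum>i\<le>n. monom (coeff p i) i) q"
    using poly_as_sum_of_monoms'[OF assms] by simp
  then show ?thesis by (simp add: pcompose_sum mon)
qed

lemma coeff_linear_power_binomial:
  fixes a b :: "'a::comm_ring_1"
  shows "coeff ([:a, b:] ^ n) i = of_nat (n choose i) * b ^ i * a ^ (n - i)"
proof (cases "i \<le> n")
  case False
  have "degree ([:a, b:] ^ n) \<le> degree [:a, b:] * n" by (rule degree_power_le)
  also have "\<dots> \<le> n" by simp
  finally show ?thesis using False by (simp add: coeff_eq_0 binomial_eq_0)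
qed (rule coeff_linear_poly_power)

lemma coeff_pcompose_shift_one:
  fixes p :: "'a::comm_ring_1 poly"
  assumes "degree p \<le> N"
  shows "coeff (pcompose p [:1, 1:]) n = (\<Sum>i\<le>N. coeff p i * of_nat (i choose n))"
  by (simp add: pcompose_eq_sum_powers[OF assms] coeff_sum coeff_linear_power_binomial)

text \<open>The subtraction cancels the top coefficient. At \<open>n\<close> it cancels
  \<open>coeff p n\<close>, leaving only the contribution of \<open>coeff p (Suc n)\<close> with
  factor \<open>Suc n choose n\<close>. Degree bounds instead of exact degrees spare case
  distinctions on vanishing coefficients.\<close>

lemma fwd_diff_degree_Suc:
  fixes p :: "'a::comm_ring_1 poly"
  assumes "degree p \<le> Suc n"
  shows "degree (fwd_diff p) \<le> n"
    and "coeff (fwd_diff p) n = of_nat (Suc n) * coeff p (Suc n)"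
proof -
  have c: "coeff (fwd_diff p) i = (\<Sum>k\<le>Suc n. coeff p k * of_nat (k choose i)) - coeff p i" for i
    by (simp add: fwd_diff_def coeff_pcompose_shift_one[OF assms] del: sum.atMost_Suc)
  show "degree (fwd_diff p) \<le> n"
  proof (rule degree_le, intro allI impI)
    fix i assume "n < i"
    then have below: "(\<Sum>k\<le>n. coeff p k * of_nat (k choose i)) = 0"
      by (intro sum.neutral) (auto simp: binomial_eq_0)
    show "coeff (fwd_diff p) i = 0"
    proof (cases "i = Suc n")
      case True
      then show ?thesis using below by (simp add: c)
    next
      case False
      then show ?thesis using \<open>n < i\<close> assms below by (simp add: c coeff_eq_0 binomial_eq_0)
    qed
  qed
  have "(\<Sum>k\<le>n. coeff p k * of_nat (k choose n)) = (\<Sum>k\<in>{n}. coeff p k * of_nat (k choose n))"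
    by (rule sum.mono_neutral_right) (auto simp: binomial_eq_0)
  then show "coeff (fwd_diff p) n = of_nat (Suc n) * coeff p (Suc n)"
    by (simp add: c algebra_simps)
qed

lemma funpow_fwd_diff_degree:
  fixes p :: "'a::comm_ring_1 poly"
  assumes "degree p \<le> l + n"
  shows "degree ((fwd_diff ^^ l) p) \<le> n
    \<and> coeff ((fwd_diff ^^ l) p) n = falling_factorial (of_nat (l + n)) l * coeff p (l + n)"
  using assms
proof (induction l arbitrary: n)
  case 0
  then show ?case by (simp add: falling_factorial_def)
next
  case (Suc l)
  then have "degree ((fwd_diff ^^ l) p) \<le> Suc n"
    "coeff ((fwd_diff ^^ l) p) (Suc n) =
       falling_factorial (of_nat (l + Suc n)) l * coeff p (l + Suc n)"
    \<comment> \<open>One more difference is still to be taken, so the hypothesis is needed one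
      degree higher; its factor \<open>Suc n\<close> completes the falling factorial.\<close>
    using Suc.IH[of "Suc n"] by auto
  with fwd_diff_degree_Suc[OF this(1)] show ?case
    by (simp add: falling_factorial_def algebra_simps)
qed

lemma funpow_fwd_diff_eq_0:
  fixes p :: "'a::comm_ring_1 poly"
  assumes "degree p < l"
  shows "(fwd_diff ^^ l) p = 0"
proof -
  obtain k where k: "l = Suc k" using assms by (cases l) auto
  then have "degree ((fwd_diff ^^ k) p) = 0"
    using funpow_fwd_diff_degree[of p k 0] assms by simp
  then obtain c where "(fwd_diff ^^ k) p = [:c:]" by (rule degree_eq_zeroE)
  then show ?thesis by (simp add: k fwd_diff_def)
qed

text \<open>With \<open>j = J - i\<close> and \<open>y(k) = x(k - J)\<close>, the factor
  \<open>x(k - i)\<close> becomes \<open>y(k + j)\<close>. Newton's formula and an exchange of sums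
  then collect exactly \<open>b_coeff\<close> in front of each difference.\<close>

lemma adjoint_eq_sum_fwd_diff:
  "adjoint J a x =
    (\<Sum>l\<le>J. b_coeff J a l * (fwd_diff ^^ l) (pcompose x [:- of_nat J, 1:]))"
proof -
  define y where "y = pcompose x [:- of_nat J, 1:]"
  have "adjoint J a x =
      (\<Sum>j\<le>J. pcompose (a (J - j)) [:- of_nat (J - j), 1:] * pcompose x [:- of_nat (J - j), 1:])"
    unfolding adjoint_def
    by (rule sum.reindex_bij_witness[where i = "\<lambda>i. J - i" and j = "\<lambda>i. J - i"]) auto
  \<comment> \<open>Padding with zeros makes the range of \<open>l\<close> independent of
    \<open>j\<close>, so that the sums can be swapped.\<close>
  also have "\<dots> = (\<Sum>j\<le>J. \<Sum>l\<le>J. if l \<le> j then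
      of_nat (j choose l) * pcompose (a (J - j)) [:of_nat j - of_nat J, 1:] * (fwd_diff ^^ l) y
      else 0)"
  proof (rule sum.cong[OF refl])
    fix j assume j: "j \<in> {..J}"
    then have "pcompose x [:- of_nat (J - j), 1:] = pcompose y [:of_nat j, 1:]"
      by (simp add: y_def of_nat_diff pcompose_pCons flip: pcompose_assoc)
    also have "\<dots> = (\<Sum>l\<le>j. of_nat (j choose l) * (fwd_diff ^^ l) y)"
      by (rule pcompose_shift_eq_sum_fwd_diff)
    also have "\<dots> = (\<Sum>l\<le>J. if l \<le> j then of_nat (j choose l) * (fwd_diff ^^ l) y else 0)"
      using j by (intro sum.mono_neutral_cong_left) auto
    finally show "pcompose (a (J - j)) [:- of_nat (J - j), 1:] * pcompose x [:- of_nat (J - j), 1:]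
      = (\<Sum>l\<le>J. if l \<le> j then
      of_nat (j choose l) * pcompose (a (J - j)) [:of_nat j - of_nat J, 1:] * (fwd_diff ^^ l) y
      else 0)"
      using j by (auto simp: sum_distrib_left of_nat_diff algebra_simps intro!: sum.cong)
  qed
  also have "\<dots> = (\<Sum>l\<le>J. \<Sum>j\<le>J. if l \<le> j then
      of_nat (j choose l) * pcompose (a (J - j)) [:of_nat j - of_nat J, 1:] * (fwd_diff ^^ l) y
      else 0)"
    by (rule sum.swap)
  also have "\<dots> = (\<Sum>l\<le>J. b_coeff J a l * (fwd_diff ^^ l) y)"
    unfolding b_coeff_def sum_distrib_right
    by (intro sum.cong[OF refl] sum.mono_neutral_cong_right) auto
  finally show ?thesis by (simp add: y_def)
qed

section \<open>Degree and leading coefficient of the adjoint's values\<close>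

lemma coeff_mult_at_degree_bounds:
  fixes p q :: "'a::comm_ring_1 poly"
  assumes "degree p \<le> m" "degree q \<le> n"
  shows "coeff (p * q) (m + n) = coeff p m * coeff q n"
proof -
  have "coeff (p * q) (m + n) = (\<Sum>i\<le>m + n. coeff p i * coeff q (m + n - i))"
    by (rule coeff_mult)
  also have "\<dots> = (\<Sum>i\<in>{m}. coeff p i * coeff q (m + n - i))"
  proof (rule sum.mono_neutral_right)
    show "\<forall>i\<in>{..m + n} - {m}. coeff p i * coeff q (m + n - i) = 0"
    proof
      fix i assume "i \<in> {..m + n} - {m}"
      then consider "m < i" | "n < m + n - i" by force
      then show "coeff p i * coeff q (m + n - i) = 0"
        using assms by cases (auto simp: coeff_eq_0)
    qed
  qed auto
  finally show ?thesis by simp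
qed

lemma degree_b_coeff_le:
  assumes "l \<le> J" "b_coeff J a l \<noteq> 0"
  shows "int (degree (b_coeff J a l)) \<le> op_degree J a + int l"
proof -
  have "int (degree (b_coeff J a l)) - int l \<le> op_degree J a"
    unfolding op_degree_def by (rule Max_ge) (use assms in auto)
  then show ?thesis by simp
qed

lemma op_degree_nonneg:
  assumes "nondegenerated J a"
  shows "0 \<le> op_degree J a"
proof (rule ccontr)
  assume neg: "\<not> 0 \<le> op_degree J a"
  \<comment> \<open>For \<open>l = 0\<close> the index is negative, where \<open>int_coeff\<close>
    is 0; for \<open>l > 0\<close> the falling factorial contains the factor 0.\<close>
  have "int_coeff (b_coeff J a l) (op_degree J a + int l) * falling_factorial 0 l = 0" for l
    using neg by (cases l) (auto simp: int_coeff_def falling_factorial_def intro!: prod_zero)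
  then have "indicial J a (of_nat 0) = 0"
    unfolding indicial_def of_nat_0 by (intro sum.neutral) blast
  with assms show False unfolding nondegenerated_def by blast
qed

lemma coeff_pcompose_monic_linear:
  fixes x :: "'a::idom poly"
  assumes "degree x \<le> s"
  shows "coeff (pcompose x [:c, 1:]) s = coeff x s"
proof (cases "degree x = s")
  case True
  then show ?thesis
    using lead_coeff_comp[of "[:c, 1:]" x] by (simp add: degree_pcompose)
next
  case False
  with assms show ?thesis by (simp add: degree_pcompose coeff_eq_0)
qed

text \<open>In the Newton form, \<open>b_coeff J a l\<close> has degree at most \<open>d + l\<close>
  and the \<open>l\<close>-th difference degree at most \<open>s - l\<close>, so every summand can
  reach \<open>d + s\<close>. The coefficients there add up to the indicial polynomial at
  \<open>s\<close>.\<close>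

lemma adjoint_leading:
  assumes d: "op_degree J a = int d" and x: "degree x \<le> s"
  shows "degree (adjoint J a x) \<le> d + s"
    and "coeff (adjoint J a x) (d + s) = indicial J a (of_nat s) * coeff x s"
proof -
  define y where "y = pcompose x [:- of_nat J, 1:]"
  have degy: "degree y \<le> s"
    using x by (simp add: y_def degree_pcompose)
  have cy: "coeff y s = coeff x s"
    unfolding y_def by (rule coeff_pcompose_monic_linear[OF x])
  have degb: "degree (b_coeff J a l) \<le> d + l" if "l \<le> J" for l
    using degree_b_coeff_le[OF that, of a] d by (cases "b_coeff J a l = 0") auto
  have summand: "degree (b_coeff J a l * (fwd_diff ^^ l) y) \<le> d + s \<and>
      coeff (b_coeff J a l * (fwd_diff ^^ l) y) (d + s) =
      int_coeff (b_coeff J a l) (op_degree J a + int l) * falling_factorial (of_nat s) l * coeff x s"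
    if l: "l \<le> J" for l
  proof (cases "l \<le> s")
    case True
    then obtain n where n: "s = l + n" by (metis le_Suc_ex)
    note F = funpow_fwd_diff_degree[OF degy[unfolded n]]
    have "degree (b_coeff J a l * (fwd_diff ^^ l) y) \<le> (d + l) + n"
      using degree_mult_le[of "b_coeff J a l" "(fwd_diff ^^ l) y"] degb[OF l] F by linarith
    moreover have "coeff (b_coeff J a l * (fwd_diff ^^ l) y) ((d + l) + n) =
        coeff (b_coeff J a l) (d + l) * coeff ((fwd_diff ^^ l) y) n"
      using degb[OF l] F by (intro coeff_mult_at_degree_bounds) auto
    ultimately show ?thesis
      using F cy d by (simp add: n int_coeff_def nat_add_distrib algebra_simps)
  next
    \<comment> \<open>For \<open>l > s\<close> the difference vanishes, and so does the falling
      factorial of \<open>s\<close>, matching the summand of \<open>indicial\<close>.\<close>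
    case False
    then have "(fwd_diff ^^ l) y = 0"
      using degy by (intro funpow_fwd_diff_eq_0) simp
    moreover have "falling_factorial (of_nat s :: 'a) l = 0"
      unfolding falling_factorial_def by (rule prod_zero) (use False in auto)
    ultimately show ?thesis by simp
  qed
  have eq: "adjoint J a x = (\<Sum>l\<le>J. b_coeff J a l * (fwd_diff ^^ l) y)"
    by (simp add: adjoint_eq_sum_fwd_diff y_def)
  show "degree (adjoint J a x) \<le> d + s"
    unfolding eq using summand by (intro degree_sum_le) auto
  show "coeff (adjoint J a x) (d + s) = indicial J a (of_nat s) * coeff x s"
    unfolding eq coeff_sum indicial_def sum_distrib_right
    using summand by (intro sum.cong) auto
qed

section \<open>Reflection symmetry and parity\<close>

lemma smult_sum_right: "smult c (sum f A) = (\<Sum>i\<in>A. smult c (f i))"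
  by (induction A rule: infinite_finite_induct) (simp_all add: smult_add_right)

lemma adjoint_smult: "adjoint J a (smult c x) = smult c (adjoint J a x)"
  by (simp add: adjoint_def pcompose_smult smult_sum_right)

text \<open>Substituting \<open>2 * \<gamma> - k\<close> for \<open>k\<close> turns the summand with
  index \<open>i\<close> into \<open>e\<close> times the one with index \<open>J - i\<close>,
  provided \<open>x\<close> is reflected by \<open>k\<close> to
  \<open>2 * \<gamma> - J - k\<close>.\<close>

lemma adjoint_reflection:
  fixes a :: "nat \<Rightarrow> 'a::field_char_0 poly"
  assumes sym: "\<And>i. i \<le> J \<Longrightarrow>
    pcompose (a i) [:\<gamma>, 1:] = smult e (pcompose (a (J - i)) [:\<gamma> - of_nat J, -1:])"
  shows "pcompose (adjoint J a x) [:2 * \<gamma>, -1:] =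
    smult e (adjoint J a (pcompose x [:2 * \<gamma> - of_nat J, -1:]))"
proof -
  have a: "pcompose (a i) [:2 * \<gamma> - of_nat i, -1:] =
      smult e (pcompose (a (J - i)) [:- of_nat (J - i), 1:])" if "i \<le> J" for i
  proof -
    have "pcompose (a i) [:2 * \<gamma> - of_nat i, -1:] =
        pcompose (pcompose (a i) [:\<gamma>, 1:]) [:\<gamma> - of_nat i, -1:]"
      by (simp add: pcompose_pCons flip: pcompose_assoc)
    also have "\<dots> = smult e (pcompose (a (J - i)) [:- of_nat (J - i), 1:])"
      using that by (simp add: sym pcompose_smult of_nat_diff pcompose_pCons flip: pcompose_assoc)
    finally show ?thesis .
  qed
  have "pcompose (adjoint J a x) [:2 * \<gamma>, -1:] =
      (\<Sum>i\<le>J. pcompose (a i) [:2 * \<gamma> - of_nat i, -1:] * pcompose x [:2 * \<gamma> - of_nat i, -1:])"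
    by (simp add: adjoint_def pcompose_sum pcompose_mult pcompose_pCons flip: pcompose_assoc)
  also have "\<dots> = (\<Sum>i\<le>J. smult e (pcompose (a (J - i)) [:- of_nat (J - i), 1:] *
      pcompose (pcompose x [:2 * \<gamma> - of_nat J, -1:]) [:- of_nat (J - i), 1:]))"
    by (intro sum.cong) (simp_all add: a of_nat_diff pcompose_pCons flip: pcompose_assoc)
  also have "\<dots> = (\<Sum>i\<le>J. smult e (pcompose (a i) [:- of_nat i, 1:] *
      pcompose (pcompose x [:2 * \<gamma> - of_nat J, -1:]) [:- of_nat i, 1:]))"
    by (rule sum.reindex_bij_witness[where i = "\<lambda>i. J - i" and j = "\<lambda>i. J - i"]) auto
  finally show ?thesis
    by (simp add: adjoint_def smult_sum_right)
qed

text \<open>For \<open>i\<close> in the upper half, the identity for \<open>J - i\<close> with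
  \<open>- J - k\<close> in place of \<open>k\<close> is the wanted one with \<open>e\<close> on the
  other side; \<open>e * e = 1\<close> moves it back.\<close>

lemma symmetry_extends:
  fixes a :: "nat \<Rightarrow> 'a::field_char_0 poly"
  assumes e: "e * e = 1"
    and sym: "\<And>i. i \<le> J div 2 \<Longrightarrow>
      pcompose (a i) [:\<gamma>, 1:] = smult e (pcompose (a (J - i)) [:\<gamma> - of_nat J, -1:])"
    and "i \<le> J"
  shows "pcompose (a i) [:\<gamma>, 1:] = smult e (pcompose (a (J - i)) [:\<gamma> - of_nat J, -1:])"
proof (cases "i \<le> J div 2")
  case False
  with \<open>i \<le> J\<close> have "J - i \<le> J div 2" "J - (J - i) = i" by auto
  then have "pcompose (a (J - i)) [:\<gamma>, 1:] = smult e (pcompose (a i) [:\<gamma> - of_nat J, -1:])"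
    using sym[of "J - i"] by simp
  then have "pcompose (pcompose (a (J - i)) [:\<gamma>, 1:]) [:- of_nat J, -1:] =
      smult e (pcompose (pcompose (a i) [:\<gamma> - of_nat J, -1:]) [:- of_nat J, -1:])"
    by (simp add: pcompose_smult)
  then have "pcompose (a (J - i)) [:\<gamma> - of_nat J, -1:] = smult e (pcompose (a i) [:\<gamma>, 1:])"
    by (simp add: pcompose_pCons flip: pcompose_assoc)
  then show ?thesis by (simp add: e)
qed (rule sym)

lemma coeff_pcompose_uminus:
  fixes p :: "'a::comm_ring_1 poly"
  shows "coeff (pcompose p [:0, -1:]) n = (-1) ^ n * coeff p n"
proof (cases "n \<le> degree p")
  case True
  have "coeff (pcompose p [:0, -1:]) n =
      (\<Sum>i\<le>degree p. coeff p i * (of_nat (i choose n) * 0 ^ (i - n) * (-1) ^ n))"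
    by (simp add: pcompose_eq_sum_powers[OF order_refl] coeff_sum coeff_linear_power_binomial mult_ac)
  \<comment> \<open>For \<open>i > n\<close> the power of 0 vanishes. For \<open>i < n\<close>
    truncated subtraction makes it \<open>0 ^ 0 = 1\<close>, but the binomial coefficient is
    0.\<close>
  also have "\<dots> = (\<Sum>i\<in>{n}. coeff p i * (of_nat (i choose n) * 0 ^ (i - n) * (-1) ^ n))"
  proof (rule sum.mono_neutral_right)
    show "\<forall>i\<in>{..degree p} - {n}. coeff p i * (of_nat (i choose n) * 0 ^ (i - n) * (-1) ^ n) = 0"
      by (auto simp: power_0_left binomial_eq_0)
  qed (use True in auto)
  finally show ?thesis by (simp add: mult.commute)
next
  case False
  have "degree (pcompose p [:0, -1:]) \<le> degree p"
    by (rule order_trans[OF degree_pcompose_le]) simp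
  with False show ?thesis by (simp add: coeff_eq_0)
qed

section \<open>Cosets, and elements of the image with pure parity\<close>

lemma op_coset_add_image:
  assumes "p \<in> adjoint_image J a"
  shows "op_coset J a (p + q) = op_coset J a q"
proof
  have neg: "- p \<in> adjoint_image J a"
    using adjoint_image_smult[OF assms, of "-1"] by simp
  show "op_coset J a (p + q) \<subseteq> op_coset J a q"
    using adjoint_image_add[OF assms] by (force simp: op_coset_def elt_set_plus_def add_ac)
  show "op_coset J a q \<subseteq> op_coset J a (p + q)"
  proof
    fix x assume "x \<in> op_coset J a q"
    then obtain v where "v \<in> adjoint_image J a" "x = q + v"
      by (auto simp: op_coset_def elt_set_plus_def)
    then show "x \<in> op_coset J a (p + q)"
      using adjoint_image_add[OF neg]
      by (auto simp: op_coset_def elt_set_plus_def intro!: bexI[of _ "- p + v"])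
  qed
qed

lemma op_coset_smult_closed:
  assumes "quot_subspace (adjoint_image J a) V" "op_coset J a p \<in> V"
  shows "op_coset J a (smult c p) \<in> V"
  using assms unfolding quot_subspace_def by (metis op_coset_scale)

lemma op_coset_sum_closed:
  assumes V: "quot_subspace (adjoint_image J a) V" and "\<And>i. i \<in> A \<Longrightarrow> op_coset J a (f i) \<in> V"
  shows "op_coset J a (sum f A) \<in> V"
proof -
  have 0: "op_coset J a 0 \<in> V"
    using V by (simp add: quot_subspace_def op_coset_def)
  have add: "op_coset J a (p + q) \<in> V" if "op_coset J a p \<in> V" "op_coset J a q \<in> V" for p q
    using V that unfolding quot_subspace_def by (metis op_coset_add)
  from assms(2) show ?thesis
    by (induction A rule: infinite_finite_induct) (auto simp: 0 add)
qed

text \<open>Supplies the relation that reduces the power \<open>d + s\<close> of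
  \<open>k - \<gamma>\<close> to lower ones of the same parity; \<open>g\<close> holds the
  coefficients with respect to \<open>k - \<gamma>\<close>.\<close>

lemma adjoint_symmetric_power:
  fixes a :: "nat \<Rightarrow> 'a::field_char_0 poly" and \<gamma> :: 'a
  assumes d: "op_degree J a = int d"
    and sym: "\<And>i. i \<le> J \<Longrightarrow>
      pcompose (a i) [:\<gamma>, 1:] = smult ((-1) ^ d) (pcompose (a (J - i)) [:\<gamma> - of_nat J, -1:])"
  shows "\<exists>g. (\<Sum>i\<le>d + s. smult (coeff g i) ([:- \<gamma>, 1:] ^ i)) \<in> adjoint_image J a \<and>
    coeff g (d + s) = indicial J a (of_nat s) \<and>
    (\<forall>i. coeff g i \<noteq> 0 \<longrightarrow> i mod 2 = (d + s) mod 2)"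
proof (intro exI conjI allI impI)
  \<comment> \<open>The root \<open>\<gamma> - J/2\<close> of \<open>k + c\<close> is the fixed
    point of \<open>k\<close> to \<open>2 * \<gamma> - J - k\<close>, so this reflection multiplies
    \<open>x\<close> by \<open>(-1) ^ s\<close>.\<close>
  define c where "c = of_nat J / 2 - \<gamma>"
  define x where "x = [:c, 1:] ^ s"
  define h where "h = adjoint J a x"
  define g where "g = pcompose h [:\<gamma>, 1:]"
  have x: "degree x = s" "coeff x s = 1"
    by (simp_all add: x_def degree_linear_power coeff_linear_power)
  have h: "h = pcompose g [:- \<gamma>, 1:]"
    by (simp add: g_def pcompose_pCons flip: pcompose_assoc)
  have degh: "degree h \<le> d + s" "coeff h (d + s) = indicial J a (of_nat s)"
    using adjoint_leading[OF d, of x s] x by (simp_all add: h_def)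
  then have degg: "degree g \<le> d + s"
    by (simp add: g_def degree_pcompose)
  have "h = (\<Sum>i\<le>d + s. smult (coeff g i) ([:- \<gamma>, 1:] ^ i))"
    unfolding h by (rule pcompose_eq_sum_powers[OF degg])
  then show "(\<Sum>i\<le>d + s. smult (coeff g i) ([:- \<gamma>, 1:] ^ i)) \<in> adjoint_image J a"
    unfolding adjoint_image_def h_def by (metis rangeI)
  show "coeff g (d + s) = indicial J a (of_nat s)"
    using coeff_pcompose_monic_linear[OF degh(1)] degh(2) by (simp add: g_def)
  have "pcompose x [:2 * \<gamma> - of_nat J, -1:] = smult ((-1) ^ s) x"
  proof -
    have "pcompose [:c, 1:] [:2 * \<gamma> - of_nat J, -1:] = smult (-1) [:c, 1:]"
      by (simp add: c_def pcompose_pCons field_simps)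
    moreover have "pcompose ([:c, 1:] ^ s) q = pcompose [:c, 1:] q ^ s" for q
      by (induction s) (simp_all add: pcompose_mult pcompose_1 del: mult_pCons_left)
    ultimately show ?thesis
      unfolding x_def by (simp only: smult_power)
  qed
  then have "pcompose h [:2 * \<gamma>, -1:] = smult ((-1) ^ (d + s)) h"
    unfolding h_def by (simp add: adjoint_reflection[of J a \<gamma>, OF sym] adjoint_smult power_add)
  then have "pcompose (pcompose h [:2 * \<gamma>, -1:]) [:\<gamma>, 1:] = smult ((-1) ^ (d + s)) g"
    by (simp add: g_def pcompose_smult)
  \<comment> \<open>In the variable \<open>k - \<gamma>\<close> the reflection about
    \<open>\<gamma>\<close> is a change of sign.\<close>
  moreover have "pcompose (pcompose h [:2 * \<gamma>, -1:]) [:\<gamma>, 1:] = pcompose g [:0, -1:]"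
    by (simp add: g_def pcompose_pCons flip: pcompose_assoc)
  ultimately have par: "(-1) ^ i * coeff g i = (-1) ^ (d + s) * coeff g i" for i
    by (metis coeff_pcompose_uminus coeff_smult)
  fix i assume "coeff g i \<noteq> 0"
  with par[of i] have "(-1 :: 'a) ^ i = (-1) ^ (d + s)" by simp
  then show "i mod 2 = (d + s) mod 2"
    by (cases "even i"; cases "even (d + s)") (simp_all add: even_iff_mod_2_eq_zero odd_iff_mod_2_eq_one)
qed

theorem theorem2p4:
  fixes a :: "nat \<Rightarrow> 'a::field_char_0 poly" and J :: nat and d :: int and \<gamma> :: 'a
  assumes "a J \<noteq> 0"
    and "d = op_degree J a"
    and "nondegenerated J a"
    and "\<And>i. i \<le> J div 2 \<Longrightarrow>
      pcompose (a i) [:\<gamma>, 1:] = smult ((-1) powi d) (pcompose (a (J - i)) [:\<gamma> - of_nat J, -1:])"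
  shows "\<forall>m::nat. 0 < m \<longrightarrow>
    op_coset J a ([:- \<gamma>, 1:] ^ m) \<in>
      quot_span (adjoint_image J a)
        {op_coset J a ([:- \<gamma>, 1:] ^ i) | i::nat. int i < d \<and> i mod 2 = m mod 2}"
proof (intro allI impI)
  fix m :: nat
  obtain D where D: "d = int D"
    using op_degree_nonneg[OF assms(3)] assms(2) nonneg_int_cases by metis
  have sym: "pcompose (a i) [:\<gamma>, 1:] =
      smult ((-1) ^ D) (pcompose (a (J - i)) [:\<gamma> - of_nat J, -1:])" if "i \<le> J" for i
    by (rule symmetry_extends[OF _ _ that])
       (use assms(4) in \<open>simp_all add: D flip: power_mult_distrib\<close>)
  let ?G = "{op_coset J a ([:- \<gamma>, 1:] ^ i) | i::nat. int i < d \<and> i mod 2 = m mod 2}"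
  \<comment> \<open>The span is the intersection of all subspaces containing the generators, so an
    arbitrary such \<open>V\<close> is considered. Strong induction runs over all exponents with the
    parity of \<open>m\<close>.\<close>
  have "op_coset J a ([:- \<gamma>, 1:] ^ n) \<in> V"
    if V: "quot_subspace (adjoint_image J a) V" "?G \<subseteq> V" and "n mod 2 = m mod 2" for V n
    using \<open>n mod 2 = m mod 2\<close>
  proof (induction n rule: less_induct)
    case (less n)
    show ?case
    proof (cases "n < D")
      case True
      with less.prems V(2) D show ?thesis by auto
    next
      case False
      then obtain s where n: "n = D + s" by (metis le_Suc_ex not_less)
      obtain g where g: "(\<Sum>i\<le>n. smult (coeff g i) ([:- \<gamma>, 1:] ^ i)) \<in> adjoint_image J a"
        "coeff g n = indicial J a (of_nat s)" "\<And>i. coeff g i \<noteq> 0 \<Longrightarrow> i mod 2 = n mod 2"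
        using adjoint_symmetric_power[of J a D \<gamma> s, OF assms(2)[symmetric, unfolded D] sym]
        unfolding n by blast
      have lead: "coeff g n \<noteq> 0"
        using assms(3) g(2) by (simp add: nondegenerated_def)
      let ?low = "\<Sum>i<n. smult (coeff g i) ([:- \<gamma>, 1:] ^ i)"
      let ?p = "\<Sum>i\<le>n. smult (coeff g i) ([:- \<gamma>, 1:] ^ i)"
      have "op_coset J a ?low \<in> V"
      proof (rule op_coset_sum_closed[OF V(1)])
        fix i assume i: "i \<in> {..<n}"
        show "op_coset J a (smult (coeff g i) ([:- \<gamma>, 1:] ^ i)) \<in> V"
        \<comment> \<open>The parity of \<open>i\<close> is known only for nonzero coefficients;
          otherwise the term is 0 and its coset is the zero of the quotient.\<close>
        proof (cases "coeff g i = 0")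
          case True
          then show ?thesis
            using V(1) by (simp add: quot_subspace_def op_coset_def)
        next
          case False
          with g(3) less.prems have "i mod 2 = m mod 2" by metis
          with i less.IH show ?thesis by (intro op_coset_smult_closed[OF V(1)]) auto
        qed
      qed
      \<comment> \<open>Nondegeneracy allows division by the leading coefficient; the multiple of
        \<open>?p\<close> lies in the image and drops out of the coset.\<close>
      moreover have "[:- \<gamma>, 1:] ^ n =
          smult (inverse (coeff g n)) ?p + smult (- inverse (coeff g n)) ?low"
        using lead by (simp add: lessThan_Suc_atMost[symmetric] smult_add_right)
      ultimately show ?thesis
        by (simp only: op_coset_add_image[OF adjoint_image_smult[OF g(1)]]
            op_coset_smult_closed[OF V(1)])
    qed
  qed
  then show "op_coset J a ([:- \<gamma>, 1:] ^ m) \<in> quot_span (adjoint_image J a) ?G"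
    unfolding quot_span_def hull_def by blast
qed

end
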